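(* Let $X$ be a normed space and let $\tau$ be a linear topology on $X$ weaker than the norm topology. Let $A,B,C\subset X$, where $B$ is nonempty, $C$ is $\tau$-closed and convex, $\operatorname{recc}C$ is pointed, $B$ is $\tau$-narrow, and $B^{\tau}_{\infty}\subset\operatorname{recc}C$. Then the inclusion $A+B\subset B+C$ implies $A\subset C$.
   Context: Normed spaces are real. A linear topology weaker than the norm topology is a vector space topology coarser than (or equal to) the norm topology. $A+B=\{a+b: a\in A,b\in B\}$. The recession cone of $C\subset X$ is $\operatorname{recc}C=\{x\in X: c+tx\in C \text{ for all } c\in C,\ t\geqslant 0\}$. A cone $V$ is pointed if $V\cap(-V)=\{0\}$. The asymptotic cone of $B$ with respect to $\tau$ is $B^{\tau}_{\infty}=\{\tau\text{-}\lim_{n\to\infty}t_nx_n : (x_n)\subset B,\ (t_n)\subset\mathbb{R},\ t_n\downarrow 0\}$ (sequences for which the limit exists). A set $B$ is $\tau$-narrow if every sequence $(x_n)\subset B$ with $\|x_n\|\to\infty$ has a subsequence $(x_{n_k})$ such that $x_{n_k}/\|x_{n_k}\|$ converges in $\tau$ to a point other than the origin. *)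

theory Defs
  imports "HOL-Analysis.Analysis" "HOL-Library.Set_Algebras"
begin

text \<open>
  The auxiliary topology is a value of type \<open>'a topology\<close>, so that it can live on the same
  type as the norm topology, which is the one carried by the type class.
  It is not assumed to be Hausdorff.
\<close>

definition linear_topology :: "'a::real_normed_vector topology \<Rightarrow> bool" where
  "linear_topology \<tau> \<longleftrightarrow>
     topspace \<tau> = UNIV \<and>
     continuous_map (prod_topology \<tau> \<tau>) \<tau> (\<lambda>(x, y). x + y) \<and>
     continuous_map (prod_topology euclideanreal \<tau>) \<tau> (\<lambda>(c, x). c *\<^sub>R x)"

definition weaker_than_norm_topology :: "'a::real_normed_vector topology \<Rightarrow> bool" where
  "weaker_than_norm_topology \<tau> \<longleftrightarrow> (\<forall>U. openin \<tau> U \<longrightarrow> open U)"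

definition recc :: "'a::real_vector set \<Rightarrow> 'a set" where
  "recc C = {x. \<forall>c\<in>C. \<forall>t\<ge>0. c + t *\<^sub>R x \<in> C}"

definition pointed :: "'a::real_vector set \<Rightarrow> bool" where
  "pointed V \<longleftrightarrow> V \<inter> uminus ` V = {0}"

text \<open>
  Here \<open>t\<^sub>n \<down> 0\<close> is read as: \<open>t\<close> is nonincreasing and converges to \<open>0\<close>.
  In particular every \<open>t\<^sub>n\<close> is nonnegative.
\<close>

definition asymptotic_cone :: "'a::real_normed_vector topology \<Rightarrow> 'a set \<Rightarrow> 'a set" where
  "asymptotic_cone \<tau> B =
     {l. \<exists>(x :: nat \<Rightarrow> 'a) (t :: nat \<Rightarrow> real).
           (\<forall>n. x n \<in> B) \<and> decseq t \<and> t \<longlonglongrightarrow> 0 \<and>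
           limitin \<tau> (\<lambda>n. t n *\<^sub>R x n) l sequentially}"

definition narrow :: "'a::real_normed_vector topology \<Rightarrow> 'a set \<Rightarrow> bool" where
  "narrow \<tau> B \<longleftrightarrow>
     (\<forall>x :: nat \<Rightarrow> 'a.
        (\<forall>n. x n \<in> B) \<and> filterlim (\<lambda>n. norm (x n)) at_top sequentially \<longrightarrow>
        (\<exists>r :: nat \<Rightarrow> nat. strict_mono r \<and>
           (\<exists>l. l \<noteq> 0 \<and> limitin \<tau> (\<lambda>k. x (r k) /\<^sub>R norm (x (r k))) l sequentially)))"

end

theory Submission
  imports Defs
begin

text \<open>
  Fix \<open>a \<in> A\<close>. Iterating the inclusion \<open>a + B \<subseteq> B + C\<close> from a point \<open>b\<^sub>0 \<in> B\<close> gives points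
  \<open>b\<^sub>n \<in> B\<close> with \<open>a + b\<^sub>n - b\<^sub>n\<^sub>+\<^sub>1 \<in> C\<close>. The first \<open>n\<close> of these differences telescope, so by convexity
  their mean \<open>m\<^sub>n = a + b\<^sub>0/n - b\<^sub>n/n\<close> lies in \<open>C\<close>
  (lemma \<open>cancellation_sequence\<close>). Everything depends on how fast \<open>\<parallel>b\<^sub>n\<parallel>\<close> grows.

  If \<open>\<parallel>b\<^sub>n\<parallel>/n\<close> does not tend to infinity, narrowness makes \<open>b\<^sub>n/n\<close> converge in \<open>\<tau>\<close> along a
  subsequence to some \<open>v\<close> in the asymptotic cone of \<open>B\<close>
  (lemma \<open>narrow_scaled_subsequence\<close>). Then \<open>m\<^sub>n\<close> converges to \<open>a - v \<in> C\<close>, and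
  \<open>a = (a - v) + v \<in> C\<close> because \<open>v\<close> is a recession direction of \<open>C\<close>.

  If \<open>\<parallel>b\<^sub>n\<parallel>/n\<close> tends to infinity, then \<open>(n/\<parallel>b\<^sub>n\<parallel>) m\<^sub>n\<close> and \<open>-b\<^sub>n/\<parallel>b\<^sub>n\<parallel>\<close> have the same limit,
  which narrowness provides as a vector \<open>-l \<noteq> 0\<close> along a subsequence. As a limit of points of \<open>C\<close>
  with multipliers tending to \<open>0\<close>, the vector \<open>-l\<close> is a recession direction of \<open>C\<close>
  (lemma \<open>scaled_limit_in_recc\<close>); as an element of the asymptotic cone of \<open>B\<close>, so is \<open>l\<close>. This
  contradicts pointedness.
\<close>

section \<open>Limits in a linear topology\<close>

lemma linear_topology_limitin_add:
  assumes "linear_topology \<tau>" "limitin \<tau> f l F" "limitin \<tau> g m F"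
  shows "limitin \<tau> (\<lambda>n. f n + g n) (l + m) F"
proof -
  have "limitin (prod_topology \<tau> \<tau>) (\<lambda>n. (f n, g n)) (l, m) F"
    using assms by (simp add: limitin_pairwise o_def)
  then have "limitin \<tau> ((\<lambda>(x, y). x + y) \<circ> (\<lambda>n. (f n, g n))) ((\<lambda>(x, y). x + y) (l, m)) F"
    using assms(1) unfolding linear_topology_def by (blast intro: continuous_map_limit)
  then show ?thesis by (simp add: o_def)
qed

lemma linear_topology_limitin_scaleR:
  assumes "linear_topology \<tau>" "(c \<longlongrightarrow> s) F" "limitin \<tau> f l F"
  shows "limitin \<tau> (\<lambda>n. c n *\<^sub>R f n) (s *\<^sub>R l) F"
proof -
  have "limitin (prod_topology euclideanreal \<tau>) (\<lambda>n. (c n, f n)) (s, l) F"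
    using assms by (simp add: limitin_pairwise o_def)
  then have "limitin \<tau> ((\<lambda>(c, x). c *\<^sub>R x) \<circ> (\<lambda>n. (c n, f n))) ((\<lambda>(c, x). c *\<^sub>R x) (s, l)) F"
    using assms(1) unfolding linear_topology_def by (blast intro: continuous_map_limit)
  then show ?thesis by (simp add: o_def)
qed

lemma linear_topology_limitin_uminus:
  assumes "linear_topology \<tau>" "limitin \<tau> f l F"
  shows "limitin \<tau> (\<lambda>n. - f n) (- l) F"
  using linear_topology_limitin_scaleR[OF assms(1) tendsto_const[of "-1"] assms(2)] by simp

lemma tendsto_imp_limitin_weaker:
  assumes "linear_topology \<tau>" "weaker_than_norm_topology \<tau>" "(f \<longlongrightarrow> l) F"
  shows "limitin \<tau> f l F"
  using assms unfolding limitin_def linear_topology_def weaker_than_norm_topology_def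
  by (auto intro: topological_tendstoD)

section \<open>Recession and asymptotic directions\<close>

text \<open>
  For \<open>c \<in> C\<close> and \<open>u \<ge> 0\<close>, the convex combinations \<open>(1 - u t\<^sub>n) c + (u t\<^sub>n) x\<^sub>n\<close>, which lie in \<open>C\<close> as soon as
  \<open>u t\<^sub>n \<le> 1\<close>, converge to \<open>c + u v\<close>.
\<close>

lemma scaled_limit_in_recc:
  fixes C :: "'a::real_normed_vector set"
  assumes lin: "linear_topology \<tau>" and weak: "weaker_than_norm_topology \<tau>"
    and clo: "closedin \<tau> C" and conv: "convex C"
    and x: "\<And>n. x n \<in> C" and t: "\<And>n. t n \<ge> 0" "t \<longlonglongrightarrow> 0"
    and lim: "limitin \<tau> (\<lambda>n. t n *\<^sub>R x n) v sequentially"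
  shows "v \<in> recc C"
  unfolding recc_def
proof (intro CollectI ballI allI impI)
  fix c and u :: real
  assume c: "c \<in> C" and u: "u \<ge> 0"
  have ut: "(\<lambda>n. u * t n) \<longlonglongrightarrow> 0"
    using tendsto_mult_right_zero[OF t(2)] by simp
  have "(\<lambda>n. (1 - u * t n) *\<^sub>R c) \<longlonglongrightarrow> (1 - 0) *\<^sub>R c"
    by (intro tendsto_intros ut)
  then have 1: "limitin \<tau> (\<lambda>n. (1 - u * t n) *\<^sub>R c) c sequentially"
    using tendsto_imp_limitin_weaker[OF lin weak] by simp
  have 2: "limitin \<tau> (\<lambda>n. u *\<^sub>R (t n *\<^sub>R x n)) (u *\<^sub>R v) sequentially"
    by (rule linear_topology_limitin_scaleR[OF lin tendsto_const lim])
  have "\<forall>\<^sub>F n in sequentially. u * t n < 1"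
    using order_tendstoD(2)[OF ut] by simp
  then have "\<forall>\<^sub>F n in sequentially. (1 - u * t n) *\<^sub>R c + u *\<^sub>R (t n *\<^sub>R x n) \<in> C"
  proof eventually_elim
    case (elim n)
    then show ?case
      using convexD[OF conv c x[of n], of "1 - u * t n" "u * t n"] u t(1)[of n] by simp
  qed
  then show "c + u *\<^sub>R v \<in> C"
    by (rule limitin_closedin[OF linear_topology_limitin_add[OF lin 1 2] clo]) simp
qed

text \<open>
  Monotonicity of the multipliers in the asymptotic cone costs nothing: a monotone subsequence of
  nonnegative reals tending to \<open>0\<close> is nonincreasing, or else identically \<open>0\<close>.
\<close>

lemma asymptotic_coneI:
  assumes x: "\<And>n. x n \<in> B" and t: "\<And>n. t n \<ge> 0" "t \<longlonglongrightarrow> 0"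
    and lim: "limitin \<tau> (\<lambda>n. t n *\<^sub>R x n) l sequentially"
  shows "l \<in> asymptotic_cone \<tau> B"
proof -
  obtain r :: "nat \<Rightarrow> nat" where r: "strict_mono r" and mono: "monoseq (\<lambda>n. t (r n))"
    using seq_monosub[of t] by blast
  have t0: "(\<lambda>n. t (r n)) \<longlonglongrightarrow> 0"
    using LIMSEQ_subseq_LIMSEQ[OF t(2) r] by (simp add: o_def)
  have "decseq (\<lambda>n. t (r n))"
  proof (cases "decseq (\<lambda>n. t (r n))")
    case False
    then have "incseq (\<lambda>n. t (r n))"
      using mono by (simp add: monoseq_iff)
    then have "t (r n) \<le> 0" for n
      using t0 incseq_le by blast
    then have "t (r n) = 0" for n
      using t(1) by (simp add: order_antisym)
    then show ?thesis by (simp add: decseq_def)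
  qed
  moreover have "limitin \<tau> (\<lambda>n. t (r n) *\<^sub>R x (r n)) l sequentially"
    using limitin_subsequence[OF r lim] by (simp add: o_def)
  ultimately show ?thesis
    using x t0 unfolding asymptotic_cone_def
    by (intro CollectI exI[of _ "\<lambda>n. x (r n)"] exI[of _ "\<lambda>n. t (r n)"]) auto
qed

lemma narrow_normalized_subsequence:
  assumes nar: "narrow \<tau> B" and x: "\<And>n. x n \<in> B"
    and inf: "filterlim (\<lambda>n. norm (x n)) at_top sequentially"
  obtains r l where "strict_mono r" "l \<noteq> 0" "l \<in> asymptotic_cone \<tau> B"
    "limitin \<tau> (\<lambda>k. x (r k) /\<^sub>R norm (x (r k))) l sequentially"
proof -
  obtain r l where r: "strict_mono r" and l: "l \<noteq> 0"
    "limitin \<tau> (\<lambda>k. x (r k) /\<^sub>R norm (x (r k))) l sequentially"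
    using nar x inf unfolding narrow_def by meson
  have "filterlim (\<lambda>k. norm (x (r k))) at_top sequentially"
    using filterlim_compose[OF inf filterlim_subseq[OF r]] .
  then have "(\<lambda>k. inverse (norm (x (r k)))) \<longlonglongrightarrow> 0"
    by (rule tendsto_inverse_0_at_top)
  then have "l \<in> asymptotic_cone \<tau> B"
    using x l(2) by (intro asymptotic_coneI[where t = "\<lambda>k. inverse (norm (x (r k)))"]) auto
  with r l that show thesis by blast
qed

text \<open>
  A subsequence makes \<open>\<parallel>x\<^sub>n\<parallel>/N\<^sub>n\<close> converge to some \<open>s\<close>. For \<open>s = 0\<close> the vectors \<open>x\<^sub>n/N\<^sub>n\<close> tend to
  \<open>0\<close> in norm; for \<open>s > 0\<close> the norms \<open>\<parallel>x\<^sub>n\<parallel>\<close> tend to infinity with \<open>N\<^sub>n\<close>, and narrowness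
  applies to \<open>x\<^sub>n/N\<^sub>n = (\<parallel>x\<^sub>n\<parallel>/N\<^sub>n) (x\<^sub>n/\<parallel>x\<^sub>n\<parallel>)\<close>.
\<close>

lemma narrow_scaled_subsequence:
  fixes B :: "'a::real_normed_vector set" and N :: "nat \<Rightarrow> real"
  assumes lin: "linear_topology \<tau>" and weak: "weaker_than_norm_topology \<tau>"
    and nar: "narrow \<tau> B" and x: "\<And>n. x n \<in> B"
    and N: "\<And>n. N n > 0" "filterlim N at_top sequentially"
    and not_inf: "\<not> filterlim (\<lambda>n. norm (x n) / N n) at_top sequentially"
  obtains r v where "strict_mono r" "v \<in> asymptotic_cone \<tau> B"
    "limitin \<tau> (\<lambda>k. x (r k) /\<^sub>R N (r k)) v sequentially"
proof -
  define q where "q n = norm (x n) / N n" for n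
  have q0: "q n \<ge> 0" for n
    using N(1)[of n] by (simp add: q_def)
  obtain K where "\<not> (\<forall>\<^sub>F n in sequentially. K \<le> q n)"
    using not_inf unfolding filterlim_at_top q_def by blast
  then obtain r1 :: "nat \<Rightarrow> nat" where r1: "strict_mono r1" "\<And>n. \<not> K \<le> q (r1 n)"
    using not_eventually_sequentiallyD by blast
  have "\<forall>n. (q \<circ> r1) n \<in> {0..K}"
    using q0 r1(2) by (simp add: less_imp_le not_le)
  then obtain s r2 where s: "s \<in> {0..K}" and r2: "strict_mono r2" "((q \<circ> r1) \<circ> r2) \<longlonglongrightarrow> s"
    using compact_imp_seq_compact[OF compact_Icc[of 0 K]] unfolding seq_compact_def by metis
  define r where "r = r1 \<circ> r2"
  have r: "strict_mono r"
    unfolding r_def using r1 r2 by (simp add: strict_mono_o)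
  have qs: "(\<lambda>k. q (r k)) \<longlonglongrightarrow> s"
    using r2(2) by (simp add: r_def o_def)
  have "\<exists>r' v. strict_mono r' \<and> limitin \<tau> (\<lambda>k. x (r' k) /\<^sub>R N (r' k)) v sequentially"
  proof (cases "s = 0")
    case True
    have "norm (x (r k) /\<^sub>R N (r k)) = q (r k)" for k
      using N(1)[of "r k"] by (simp add: q_def field_simps)
    then have "(\<lambda>k. x (r k) /\<^sub>R N (r k)) \<longlonglongrightarrow> 0"
      using qs True by (subst tendsto_norm_zero_iff[symmetric]) simp
    then show ?thesis
      using r tendsto_imp_limitin_weaker[OF lin weak] by blast
  next
    case False
    then have "s > 0" using s by simp
    have norm_x: "norm (x n) = q n * N n" for n
      using N(1)[of n] by (simp add: q_def)
    have "filterlim (\<lambda>k. q (r k) * N (r k)) at_top sequentially"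
      by (rule filterlim_tendsto_pos_mult_at_top[OF qs \<open>s > 0\<close>
            filterlim_compose[OF N(2) filterlim_subseq[OF r]]])
    then have "filterlim (\<lambda>k. norm (x (r k))) at_top sequentially"
      by (simp add: norm_x)
    then obtain r3 l where r3: "strict_mono r3" and
      l: "limitin \<tau> (\<lambda>k. x (r (r3 k)) /\<^sub>R norm (x (r (r3 k)))) l sequentially"
      using narrow_normalized_subsequence[OF nar, of "\<lambda>k. x (r k)"] x by blast
    have "(\<lambda>k. q (r (r3 k))) \<longlonglongrightarrow> s"
      using LIMSEQ_subseq_LIMSEQ[OF qs r3] by (simp add: o_def)
    from linear_topology_limitin_scaleR[OF lin this l]
    have "limitin \<tau> (\<lambda>k. q (r (r3 k)) *\<^sub>R (x (r (r3 k)) /\<^sub>R norm (x (r (r3 k))))) (s *\<^sub>R l) sequentially" .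
    moreover have "q n *\<^sub>R (x n /\<^sub>R norm (x n)) = x n /\<^sub>R N n" for n
      by (cases "x n = 0") (simp_all add: q_def field_simps)
    ultimately have "limitin \<tau> (\<lambda>k. x (r (r3 k)) /\<^sub>R N (r (r3 k))) (s *\<^sub>R l) sequentially"
      by (simp only:)
    then show ?thesis
      using strict_mono_o[OF r r3] by (intro exI[of _ "r \<circ> r3"]) auto
  qed
  then obtain r' v where r': "strict_mono r'"
    and v: "limitin \<tau> (\<lambda>k. x (r' k) /\<^sub>R N (r' k)) v sequentially"
    by blast
  have "(\<lambda>k. inverse (N (r' k))) \<longlonglongrightarrow> 0"
    using filterlim_compose[OF N(2) filterlim_subseq[OF r']] by (rule tendsto_inverse_0_at_top)
  then have "v \<in> asymptotic_cone \<tau> B"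
    using x v N(1)
    by (intro asymptotic_coneI[where t = "\<lambda>k. inverse (N (r' k))"]) (auto simp: less_imp_le)
  with r' v that show thesis by blast
qed

section \<open>Cancellation\<close>

text \<open>
  The sequence starts at the point \<open>b\<^sub>1\<close> after \<open>b\<^sub>0\<close>, so that the \<open>n\<close>-th term comes from averaging
  \<open>n + 1\<close> points of \<open>C\<close> and the divisor never vanishes.
\<close>

lemma cancellation_sequence:
  fixes B C :: "'a::real_vector set"
  assumes conv: "convex C" and b0: "b0 \<in> B" and sub: "{a} + B \<subseteq> B + C"
  obtains x where "\<And>n::nat. x n \<in> B"
    "\<And>n. a + b0 /\<^sub>R real (Suc n) - x n /\<^sub>R real (Suc n) \<in> C"
proof -
  have step: "\<exists>b'. b' \<in> B \<and> a + b - b' \<in> C" if b: "b \<in> B" for b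
  proof -
    have "a + b \<in> B + C" using sub b by (auto simp: set_plus_def)
    then show ?thesis by (auto simp: set_plus_def)
  qed
  have "\<exists>b. \<forall>n::nat. (b n \<in> B \<and> (n = 0 \<longrightarrow> b n = b0)) \<and> a + b n - b (Suc n) \<in> C"
    by (rule dependent_nat_choice) (use b0 step in auto)
  then obtain b where b: "\<And>n::nat. b n \<in> B" "b 0 = b0" "\<And>n. a + b n - b (Suc n) \<in> C"
    by blast
  have "a + b0 /\<^sub>R real (Suc n) - b (Suc n) /\<^sub>R real (Suc n) \<in> C" for n
  proof -
    have tele: "(\<Sum>i<m. a + b i - b (Suc i)) = real m *\<^sub>R a + b0 - b m" for m
      by (induction m) (simp_all add: b(2) algebra_simps)
    have "(\<Sum>i<Suc n. inverse (real (Suc n)) *\<^sub>R (a + b i - b (Suc i))) \<in> C"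
      by (rule convex_sum[OF _ conv]) (use b(3) in auto)
    also have "(\<Sum>i<Suc n. inverse (real (Suc n)) *\<^sub>R (a + b i - b (Suc i)))
        = inverse (real (Suc n)) *\<^sub>R (real (Suc n) *\<^sub>R a + b0 - b (Suc n))"
      by (simp only: tele scaleR_sum_right[symmetric])
    also have "\<dots> = a + b0 /\<^sub>R real (Suc n) - b (Suc n) /\<^sub>R real (Suc n)"
      by (simp only: scaleR_diff_right scaleR_add_right scaleR_scaleR) simp
    finally show ?thesis .
  qed
  then show thesis using that[of "\<lambda>n. b (Suc n)"] b(1) by blast
qed

theorem theorem4p7:
  fixes \<tau> :: "'a::real_normed_vector topology"
    and A B C :: "'a set"
  assumes "linear_topology \<tau>"
    and "weaker_than_norm_topology \<tau>"
    and "B \<noteq> {}"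
    and "closedin \<tau> C"
    and "convex C"
    and "pointed (recc C)"
    and "narrow \<tau> B"
    and "asymptotic_cone \<tau> B \<subseteq> recc C"
    and "A + B \<subseteq> B + C"
  shows "A \<subseteq> C"
proof
  note lin = assms(1) and weak = assms(2)
  fix a assume a: "a \<in> A"
  obtain b0 where b0: "b0 \<in> B" using assms(3) by blast
  have "{a} + B \<subseteq> B + C"
    using set_plus_mono2[of "{a}" A B B] a assms(9) by auto
  then obtain x where x: "\<And>n::nat. x n \<in> B"
    and mean: "\<And>n. a + b0 /\<^sub>R real (Suc n) - x n /\<^sub>R real (Suc n) \<in> C"
    using cancellation_sequence[OF assms(5) b0] by blast
  define N where "N n = real (Suc n)" for n
  have N: "N n > 0" for n by (simp add: N_def)
  have Ninf: "filterlim N at_top sequentially"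
    unfolding N_def by (rule filterlim_compose[OF filterlim_real_sequentially filterlim_Suc])
  have mean': "a + b0 /\<^sub>R N n - x n /\<^sub>R N n \<in> C" for n
    using mean by (simp add: N_def)
  have b0N: "(\<lambda>n. a + b0 /\<^sub>R N n) \<longlonglongrightarrow> a"
    using tendsto_add[OF tendsto_const[of a]
        tendsto_scaleR[OF tendsto_inverse_0_at_top[OF Ninf] tendsto_const[of b0]]]
    by simp
  show "a \<in> C"
  proof (cases "filterlim (\<lambda>n. norm (x n) / N n) at_top sequentially")
    case False
    then obtain r v where r: "strict_mono r" and v: "v \<in> asymptotic_cone \<tau> B"
      and xv: "limitin \<tau> (\<lambda>k. x (r k) /\<^sub>R N (r k)) v sequentially"
      using narrow_scaled_subsequence[OF lin weak assms(7), of x N] x N Ninf by blast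
    have "(\<lambda>k. a + b0 /\<^sub>R N (r k)) \<longlonglongrightarrow> a"
      using LIMSEQ_subseq_LIMSEQ[OF b0N r] by (simp add: o_def)
    from linear_topology_limitin_add[OF lin tendsto_imp_limitin_weaker[OF lin weak this]
        linear_topology_limitin_uminus[OF lin xv]]
    have "limitin \<tau> (\<lambda>k. a + b0 /\<^sub>R N (r k) - x (r k) /\<^sub>R N (r k)) (a - v) sequentially"
      by simp
    then have "a - v \<in> C"
      by (rule limitin_closedin[OF _ assms(4)]) (use mean' in auto)
    moreover have "v \<in> recc C" using v assms(8) by blast
    ultimately have "(a - v) + 1 *\<^sub>R v \<in> C"
      unfolding recc_def using zero_le_one by blast
    then show ?thesis by simp
  next
    case True
    have "norm (x n) / N n \<le> norm (x n)" for n
      by (simp add: N_def divide_le_eq mult_le_cancel_left1)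
    then have "filterlim (\<lambda>n. norm (x n)) at_top sequentially"
      using filterlim_at_top_mono[OF True] by simp
    then obtain r l where r: "strict_mono r" and l: "l \<noteq> 0" "l \<in> asymptotic_cone \<tau> B"
      and xl: "limitin \<tau> (\<lambda>k. x (r k) /\<^sub>R norm (x (r k))) l sequentially"
      using narrow_normalized_subsequence[OF assms(7), of x] x by blast
    define t where "t n = inverse (norm (x n) / N n)" for n
    have t: "(\<lambda>k. t (r k)) \<longlonglongrightarrow> 0"
      unfolding t_def
      by (rule tendsto_inverse_0_at_top[OF filterlim_compose[OF True filterlim_subseq[OF r]]])
    have "(\<lambda>k. t (r k) *\<^sub>R (a + b0 /\<^sub>R N (r k))) \<longlonglongrightarrow> 0"
      using tendsto_scaleR[OF t LIMSEQ_subseq_LIMSEQ[OF b0N r]] by (simp add: o_def)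
    from linear_topology_limitin_add[OF lin tendsto_imp_limitin_weaker[OF lin weak this]
        linear_topology_limitin_uminus[OF lin xl]]
    have "limitin \<tau> (\<lambda>k. t (r k) *\<^sub>R (a + b0 /\<^sub>R N (r k)) - x (r k) /\<^sub>R norm (x (r k))) (- l)
        sequentially"
      by simp
    moreover have "x n /\<^sub>R norm (x n) = t n *\<^sub>R (x n /\<^sub>R N n)" for n
      using N[of n] by (simp add: t_def inverse_eq_divide)
    ultimately have "limitin \<tau> (\<lambda>k. t (r k) *\<^sub>R (a + b0 /\<^sub>R N (r k) - x (r k) /\<^sub>R N (r k))) (- l)
        sequentially"
      by (simp only: scaleR_diff_right)
    then have "- l \<in> recc C"
      using mean' t N
      by (intro scaled_limit_in_recc[OF lin weak assms(4,5), where t = "\<lambda>k. t (r k)"])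
        (auto simp: t_def less_imp_le)
    then have "l \<in> recc C \<inter> uminus ` recc C"
      using l(2) assms(8) by (auto intro: image_eqI[of _ _ "- l"])
    then show ?thesis
      using assms(6) l(1) unfolding pointed_def by blast
  qed
qed

end
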